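(* For every integer $N>3$, there exists a complex-valued signal $x$ with support $\{0,\dots,N-1\}$ such that $x$ cannot be uniquely recovered from $|\widehat x|$ and $|x|=(|x[n]|)_{n\in\mathbb Z}$ up to rotations.
   Context: A (discrete-time) signal is a sequence $x=(x[n])_{n\in\mathbb Z}$ of complex numbers. It has support $\{0,\dots,N-1\}$ if $x[n]=0$ for $n\notin\{0,\dots,N-1\}$ and $x[0]\neq0$, $x[N-1]\ne 0$ (interior values may vanish). Its Fourier transform is $\widehat x(\omega)=\sum_{n\in\mathbb Z}x[n]e^{-i\omega n}$, $\omega\in\mathbb R$, and $|\widehat x|$ is the function $\omega\mapsto|\widehat x(\omega)|$. "$x$ can be uniquely recovered from $|\widehat x|$ and $|x|$ up to rotations" means that every signal $y$ with support $\{0,\dots,N-1\}$ satisfying $|\widehat y(\omega)|=|\widehat x(\omega)|$ for all $\omega\in\mathbb R$ and $|y[n]|=|x[n]|$ for all $n\in\mathbb Z$ is of the form $y=e^{i\alpha}x$ with $\alpha\in\mathbb R$. *)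

theory Defs
  imports "HOL-Analysis.Analysis"
begin

type_synonym signal = "int \<Rightarrow> complex"

text \<open>Only the two end values are required to be nonzero; interior values may vanish.\<close>

definition has_support :: "signal \<Rightarrow> int \<Rightarrow> bool" where
  "has_support x N \<longleftrightarrow> (\<forall>n. n \<notin> {0..N - 1} \<longrightarrow> x n = 0) \<and> x 0 \<noteq> 0 \<and> x (N - 1) \<noteq> 0"

text \<open>
  The series over all integers is an unconditional sum (\<open>infsum\<close>), which for finitely
  supported signals is just the finite sum over the support.
\<close>

definition fourier :: "signal \<Rightarrow> real \<Rightarrow> complex" where
  "fourier x \<omega> = (\<Sum>\<^sub>\<infinity>n\<in>UNIV. x n * exp (- \<i> * of_real \<omega> * of_int n))"

definition uniquely_recoverable :: "int \<Rightarrow> signal \<Rightarrow> bool" where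
  "uniquely_recoverable N x \<longleftrightarrow>
     (\<forall>y. has_support y N \<longrightarrow>
          (\<forall>\<omega>. cmod (fourier y \<omega>) = cmod (fourier x \<omega>)) \<longrightarrow>
          (\<forall>n. cmod (y n) = cmod (x n)) \<longrightarrow>
          (\<exists>\<alpha>::real. y = (\<lambda>n. exp (\<i> * of_real \<alpha>) * x n)))"

end

theory Submission
  imports Defs
begin

text \<open>
  Reflecting a signal about the midpoint of \<open>{0..N - 1}\<close> and conjugating it conjugates its Fourier
  transform up to the unimodular factor \<open>exp (- \<i> \<omega> (N - 1))\<close>, so the Fourier magnitudes are blind
  to this operation. If the magnitudes \<open>cmod (x n)\<close> are moreover symmetric about the midpoint, they
  cannot detect it either. Hence uniqueness up to rotation fails for any such \<open>x\<close> that is not a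
  rotation of its own conjugate reflection. The palindrome \<open>(1, \<i>, 0, \<dots>, 0, \<i>, 1)\<close> is an example:
  its conjugate reflection is its plain conjugate, where the equal end values force the rotation to
  be trivial while \<open>\<i>\<close> and \<open>- \<i>\<close> differ.
\<close>

definition conj_reflection :: "int \<Rightarrow> signal \<Rightarrow> signal" where
  "conj_reflection N x = (\<lambda>n. cnj (x (N - 1 - n)))"

lemma has_support_conj_reflection:
  assumes "has_support x N"
  shows "has_support (conj_reflection N x) N"
  using assms by (auto simp: has_support_def conj_reflection_def)

text \<open>
  Substituting \<open>n \<mapsto> N - 1 - n\<close> reverses the sign of the frequency, and conjugation restores it;
  only the phase of the shift by \<open>N - 1\<close> is left over.
\<close>

lemma fourier_conj_reflection:
  "fourier (conj_reflection N x) \<omega> = exp (- \<i> * of_real \<omega> * of_int (N - 1)) * cnj (fourier x \<omega>)"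
proof -
  let ?e = "\<lambda>n::int. exp (- \<i> * of_real \<omega> * of_int n) :: complex"
  have phase: "?e (N - 1 - n) = ?e (N - 1) * cnj (?e n)" for n
    by (simp add: exp_cnj exp_add [symmetric] algebra_simps)
  have bij: "bij_betw (\<lambda>n. N - 1 - n) UNIV (UNIV :: int set)"
    by (rule bij_betwI [where g = "\<lambda>n. N - 1 - n"]) auto
  have "fourier (conj_reflection N x) \<omega> = (\<Sum>\<^sub>\<infinity>n. cnj (x n) * ?e (N - 1 - n))"
    unfolding fourier_def
    by (subst infsum_reindex_bij_betw [OF bij, symmetric]) (simp add: conj_reflection_def)
  also have "\<dots> = (\<Sum>\<^sub>\<infinity>n. ?e (N - 1) * cnj (x n * ?e n))"
    unfolding phase by (simp add: mult_ac)
  also have "\<dots> = ?e (N - 1) * cnj (fourier x \<omega>)"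
    by (simp only: infsum_cmult_right' infsum_cnj fourier_def)
  finally show ?thesis .
qed

lemma cmod_fourier_conj_reflection:
  "cmod (fourier (conj_reflection N x) \<omega>) = cmod (fourier x \<omega>)"
  by (simp add: fourier_conj_reflection norm_mult)

lemma not_uniquely_recoverable_if_symmetric_cmod:
  assumes "has_support x N"
    and "\<And>n. cmod (x (N - 1 - n)) = cmod (x n)"
    and "\<And>\<alpha>::real. conj_reflection N x \<noteq> (\<lambda>n. exp (\<i> * of_real \<alpha>) * x n)"
  shows "\<not> uniquely_recoverable N x"
proof
  assume "uniquely_recoverable N x"
  moreover have "cmod (conj_reflection N x n) = cmod (x n)" for n
    by (simp add: conj_reflection_def assms(2))
  ultimately show False
    using has_support_conj_reflection [OF assms(1)] cmod_fourier_conj_reflection [of N x] assms(3)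
    unfolding uniquely_recoverable_def by blast
qed

theorem theorem3p6:
  fixes N :: int
  assumes "N > 3"
  shows "\<exists>x. has_support x N \<and> \<not> uniquely_recoverable N x"
proof -
  define x :: signal where
    "x = (\<lambda>n. if n = 0 \<or> n = N - 1 then 1 else if n = 1 \<or> n = N - 2 then \<i> else 0)"
  have support: "has_support x N"
    using assms by (auto simp: has_support_def x_def)
  have palindrome: "x (N - 1 - n) = x n" for n
    by (auto simp: x_def)
  have not_rotation: "conj_reflection N x \<noteq> (\<lambda>n. exp (\<i> * of_real \<alpha>) * x n)" for \<alpha> :: real
  proof
    assume "conj_reflection N x = (\<lambda>n. exp (\<i> * of_real \<alpha>) * x n)"
    then have rotation: "cnj (x n) = exp (\<i> * of_real \<alpha>) * x n" for n
      by (metis conj_reflection_def palindrome)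
    have "exp (\<i> * of_real \<alpha>) = 1"
      using rotation [of 0] by (simp add: x_def)
    then have "cnj (x 1) = x 1"
      using rotation [of 1] by simp
    moreover have "x 1 = \<i>"
      using assms by (simp add: x_def)
    ultimately show False
      by (simp add: complex_eq_iff)
  qed
  show ?thesis
    using support not_uniquely_recoverable_if_symmetric_cmod [OF support _ not_rotation] palindrome
    by auto
qed

end
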